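(* Let $k>1$ and $s\ge 1$ be integers with $s\le\lfloor k/2\rfloor$. Then for all integers $n\ge 0$: \begin{align*} p_{-(5^{k}-2b)/b}\left(5^{2s} n+5^{2s-1} r+\frac{5^{2s}-1}{12}\right)&\equiv 0 \pmod{5^{k-2s+1}}, && r\in\{1,2,3,4\},\\ p_{-(7^{k}-2b)/b}\left(7^{2s} n+7^{2s-1} r+\frac{7^{2s}-1}{12}\right)&\equiv 0 \pmod{7^{k-2s+1}}, && r\in\{1,2,\ldots,6\},\\ p_{-(11^{k}-2b)/b}\left(11^{2s} n+11^{2s-1} r+\frac{11^{2s}-1}{12}\right)&\equiv 0 \pmod{11^{k-2s+1}}, && r\in\{1,2,\ldots,10\}, \end{align*} where in each congruence $b$ is any positive integer coprime to the modulus (i.e. to $5$, $7$, $11$ respectively).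
   Context: For a rational number $t\neq 0$, the rational numbers $p_t(n)$, $n\ge 0$, are defined by the formal power series identity $\sum_{n\ge 0}p_t(n)q^n=\prod_{j\ge 1}(1-q^j)^t$, where each factor $(1-q^j)^t$ is the binomial series with constant term $1$. For a prime $\ell$ not dividing the denominator of $t$, a congruence $p_t(N)\equiv 0\pmod{\ell^k}$ means that the numerator of $p_t(N)$, written as a reduced fraction, is divisible by $\ell^k$ (the denominator of $p_t(N)$ is then coprime to $\ell$). *)

theory Defs
  imports "HOL-Analysis.Analysis"
begin

text \<open>
  \<open>binom_factor t j\<close> is $(1-q^{j+1})^t$: the binomial series $(1+x)^t$ at $x = -q^{j+1}$.
  The infinite product is taken in the $q$-adic topology on formal power series; that it converges
  (so that \<open>prodinf\<close> is not a junk value) is shown below.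
\<close>

definition binom_factor :: "rat \<Rightarrow> nat \<Rightarrow> rat fps" where
  "binom_factor t j = fps_binomial t oo (- (fps_X ^ Suc j))"

definition frac_part :: "rat \<Rightarrow> nat \<Rightarrow> rat" where
  "frac_part t n = fps_nth (\<Prod>j. binom_factor t j) n"

text \<open>Note that \<open>quotient_of\<close> returns the reduced fraction with positive denominator.\<close>

definition rat_cong_zero :: "rat \<Rightarrow> int \<Rightarrow> bool" where
  "rat_cong_zero x m \<longleftrightarrow> m dvd fst (quotient_of x)"

lemma binom_factor_nth_0 [simp]: "fps_nth (binom_factor t j) 0 = 1"
  by (simp add: binom_factor_def)

lemma binom_factor_nth_eq_0:
  assumes "0 < m" "m \<le> j"
  shows "fps_nth (binom_factor t j) m = 0"
proof -
  have "fps_nth ((- (fps_X ^ Suc j) :: rat fps) ^ l) m = 0" for l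
  proof (cases l)
    case 0
    then show ?thesis using assms by simp
  next
    case (Suc k)
    have "(- (fps_X ^ Suc j) :: rat fps) ^ l = fps_X ^ Suc j * (- ((- (fps_X ^ Suc j)) ^ k))"
      by (simp add: Suc)
    then show ?thesis using assms
      by (simp only: fps_X_power_mult_nth) simp
  qed
  then show ?thesis
    unfolding binom_factor_def fps_compose_nth by (intro sum.neutral) simp
qed

lemma prod_binom_factor_nth_stable:
  assumes "n \<le> N"
  shows "fps_nth (\<Prod>j\<le>N. binom_factor t j) n = fps_nth (\<Prod>j\<le>n. binom_factor t j) n"
  using assms
proof (induction N rule: dec_induct)
  case (step N)
  let ?P = "\<Prod>j\<le>N. binom_factor t j" and ?f = "binom_factor t (Suc N)"
  have "fps_nth (?P * ?f) n = (\<Sum>i=0..n. fps_nth ?P i * fps_nth ?f (n - i))"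
    by (simp add: fps_mult_nth)
  also have "\<dots> = (\<Sum>i\<in>{n}. fps_nth ?P i * fps_nth ?f (n - i))"
    using step.hyps by (intro sum.mono_neutral_right) (auto simp: binom_factor_nth_eq_0)
  finally show ?case using step.IH by simp
qed simp

lemma binom_factor_has_prod:
  "binom_factor t has_prod Abs_fps (\<lambda>n. fps_nth (\<Prod>j\<le>n. binom_factor t j) n)"
  (is "_ has_prod ?P")
proof -
  have "(\<lambda>n. \<Prod>j\<le>n. binom_factor t j) \<longlonglongrightarrow> ?P"
  proof (rule tendsto_fpsI)
    fix n
    have "\<forall>\<^sub>F N in sequentially.
        fps_nth (\<Prod>j\<le>N. binom_factor t j) n = fps_nth (\<Prod>j\<le>n. binom_factor t j) n"
      by (rule eventually_sequentiallyI) (rule prod_binom_factor_nth_stable)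
    then show "\<forall>\<^sub>F N in sequentially. fps_nth (\<Prod>j\<le>N. binom_factor t j) n = fps_nth ?P n"
      by (simp only: fps_nth_Abs_fps)
  qed
  moreover have "?P \<noteq> 0"
    by (rule fps_nonzeroI[of _ 0]) simp
  ultimately show ?thesis by (simp add: has_prod_def raw_has_prod_def)
qed

lemma frac_part_eq: "frac_part t n = fps_nth (\<Prod>j\<le>n. binom_factor t j) n"
  using has_prod_unique[OF binom_factor_has_prod, of t, symmetric] by (simp add: frac_part_def)

end

theory Submission
  imports Defs "HOL-Number_Theory.Cong"
begin

text \<open>
  Write $t = 2 + \alpha$ with $\alpha = -\ell^k/b$. Since
  ${\alpha \choose m} = \frac{\alpha}{m}{\alpha - 1 \choose m - 1}$, the coefficient of $x^m$ in
  $(1+x)^\alpha$ is divisible by $\ell^{k-2s+1}$ unless $\ell^{2s} \mid m$, and this property is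
  inherited by $\prod_j (1-q^j)^\alpha$. Hence modulo $\ell^{k-2s+1}$ only those $p_2(i)$ with
  $\ell^{2s} \mid N - i$ contribute to $p_t(N)$. For such $i$, the prime $\ell$ divides $12i+1$ to the exact odd
  power $2s-1$, which forces $p_2(i) = 0$: Euler's pentagonal number theorem gives a representation
  $24i+2 = x^2+y^2$ whenever $p_2(i) \neq 0$, and combined with Gauss's identity
  $\prod_j (1-q^j)^2 = \prod_j (1-q^{2j}) \cdot \sum_n (-1)^n q^{n^2}$ it gives
  $12i+1 = x^2+12y^2$. The first form is anisotropic modulo 7, the second modulo 5 and 11.
\<close>

subsection \<open>Finite forms of the identities of Euler and Gauss\<close>

text \<open>
  The summand for $s = 0$ is $\prod_{j \le n} (1-q^j)$ and all others are divisible by $q^{n+1}$,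
  so this is the pentagonal number theorem modulo $q^{n+1}$.
\<close>

lemma shanks_pentagonal:
  fixes q :: "'a::comm_ring_1"
  shows "(\<Sum>s\<le>n. (-1)^s * q ^ (s * n + \<Sum>{..s}) * (\<Prod>j=Suc s..n. 1 - q ^ j)) =
    1 + (\<Sum>s<n. (-1) ^ Suc s * (q ^ (Suc s * s + \<Sum>{..Suc s}) + q ^ (Suc s * Suc s + \<Sum>{..Suc s})))"
proof (induction n)
  case (Suc n)
  define T where "T N s = (-1)^s * q ^ (s * N + \<Sum>{..s}) * (\<Prod>j=Suc s..N. 1 - q ^ j)" for N s
  \<comment> \<open>The factor 1 - q^(m+1) split off the remainder after step m makes it combine
    with the next difference. At m = n the product is empty and the remainder is the first new
    pentagonal term; the summand of index n + 1 is the second.\<close>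
  have telescope: "m \<le> n \<Longrightarrow> (\<Sum>s\<le>m. T (Suc n) s - T n s) =
      - ((-1)^m * q ^ (Suc m * n + \<Sum>{..Suc m}) * (\<Prod>j=Suc m..n. 1 - q ^ j))" for m
  proof (induction m)
    case 0
    then show ?case by (simp add: T_def algebra_simps)
  next
    case (Suc m)
    then have "(\<Prod>j=Suc m..n. 1 - q ^ j) = (1 - q ^ Suc m) * (\<Prod>j=Suc (Suc m)..n. 1 - q ^ j)"
      by (intro prod.atLeast_Suc_atMost) auto
    with Suc show ?case
      by (simp add: T_def algebra_simps power_add)
  qed
  have "(\<Sum>s\<le>Suc n. T (Suc n) s) =
      (\<Sum>s\<le>n. T n s) + (\<Sum>s\<le>n. T (Suc n) s - T n s) + T (Suc n) (Suc n)"
    by (simp add: sum_subtractf)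
  also have "(\<Sum>s\<le>n. T (Suc n) s - T n s) = (-1) ^ Suc n * q ^ (Suc n * n + \<Sum>{..Suc n})"
    by (simp add: telescope)
  also have "T (Suc n) (Suc n) = (-1) ^ Suc n * q ^ (Suc n * Suc n + \<Sum>{..Suc n})"
    by (simp add: T_def)
  finally show ?case
    using Suc.IH unfolding T_def by (simp add: algebra_simps)
qed simp

text \<open>
  The factor of index $0$ in the product over $j < s$ is 2; it accounts for the coefficient 2 of the
  theta series.
\<close>
lemma shanks_gauss:
  fixes q :: "'a::comm_ring_1"
  shows "(\<Sum>s\<le>n. (-1)^s * q ^ (s * Suc n) * (\<Prod>j<s. 1 + q ^ j) * (\<Prod>j=Suc s..n. 1 - q ^ j)) =
    (\<Prod>j=1..n. 1 + q ^ j) * (1 + 2 * (\<Sum>s<n. (-1) ^ Suc s * q ^ (Suc s)\<^sup>2))"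
proof (induction n)
  case (Suc n)
  define T where "T N s = (-1)^s * q ^ (s * Suc N) * (\<Prod>j<s. 1 + q ^ j) * (\<Prod>j=Suc s..N. 1 - q ^ j)"
    for N s
  \<comment> \<open>The outer product on the right gains the factor 1 + q^(n+1), so
    \<open>T (Suc n)\<close> is compared with that multiple of \<open>T n\<close>; it is these
    differences that telescope.\<close>
  have telescope: "m \<le> n \<Longrightarrow> (\<Sum>s\<le>m. T (Suc n) s - (1 + q ^ Suc n) * T n s) =
      - ((-1)^m * q ^ (Suc m * Suc n) * (\<Prod>j\<le>m. 1 + q ^ j) * (\<Prod>j=Suc m..n. 1 - q ^ j))" for m
  proof (induction m)
    case 0
    then show ?case by (simp add: T_def algebra_simps)
  next
    case (Suc m)
    then have "(\<Prod>j=Suc m..n. 1 - q ^ j) = (1 - q ^ Suc m) * (\<Prod>j=Suc (Suc m)..n. 1 - q ^ j)"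
      by (intro prod.atLeast_Suc_atMost) auto
    with Suc show ?case
      by (simp add: T_def algebra_simps power_add lessThan_Suc_atMost)
  qed
  have "(\<Prod>j\<le>n. 1 + q ^ j) = 2 * (\<Prod>j=1..n. 1 + q ^ j)"
    by (simp add: atMost_atLeast0 prod.atLeast_Suc_atMost)
  moreover have "(\<Sum>s\<le>Suc n. T (Suc n) s) = (1 + q ^ Suc n) * (\<Sum>s\<le>n. T n s)
      + (\<Sum>s\<le>n. T (Suc n) s - (1 + q ^ Suc n) * T n s) + T (Suc n) (Suc n)"
    by (simp add: sum_subtractf sum_distrib_left)
  moreover have "(\<Sum>s\<le>n. T (Suc n) s - (1 + q ^ Suc n) * T n s) =
      (-1) ^ Suc n * q ^ (Suc n)\<^sup>2 * (\<Prod>j\<le>n. 1 + q ^ j)"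
    by (subst telescope) (simp_all add: power2_eq_square)
  moreover have "T (Suc n) (Suc n) =
      (-1) ^ Suc n * q ^ (Suc n)\<^sup>2 * q ^ Suc n * (\<Prod>j\<le>n. 1 + q ^ j)"
  proof -
    have "Suc n * Suc (Suc n) = (Suc n)\<^sup>2 + Suc n" by (simp add: power2_eq_square)
    then show ?thesis unfolding T_def
      by (simp only: power_add lessThan_Suc_atMost) simp
  qed
  \<comment> \<open>The telescoped remainder and the last summand both carry q^((n+1)^2), with
    weights 1 and q^(n+1). Together they give the factor that extends the product.\<close>
  ultimately have "(\<Sum>s\<le>Suc n. T (Suc n) s) =
      (1 + q ^ Suc n) * (\<Sum>s\<le>n. T n s) +
      (1 + q ^ Suc n) * (\<Prod>j=1..n. 1 + q ^ j) * (2 * ((-1) ^ Suc n * q ^ (Suc n)\<^sup>2))"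
    by (simp only:) (simp add: algebra_simps)
  then show ?case
    using Suc.IH unfolding T_def by (simp add: algebra_simps)
qed simp

subsection \<open>Support of the Euler function and its square\<close>

lemma fps_nth_mult_nonzeroE:
  assumes "fps_nth (F * G) n \<noteq> (0 :: 'a::semiring_0)"
  obtains i where "i \<le> n" "fps_nth F i \<noteq> 0" "fps_nth G (n - i) \<noteq> 0"
proof -
  from assms obtain i where "i \<in> {0..n}" "fps_nth F i * fps_nth G (n - i) \<noteq> 0"
    unfolding fps_mult_nth by (meson sum.not_neutral_contains_not_neutral)
  then show ?thesis by (intro that[of i]) auto
qed

lemma fps_nth_signed_monomial_mult_eq_0:
  fixes F :: "'a::comm_ring_1 fps"
  assumes "i < m"
  shows "fps_nth ((-1) ^ s * fps_X ^ m * F) i = 0"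
proof -
  have "(-1) ^ s * fps_X ^ m * F = fps_X ^ m * ((-1) ^ s * F)" by (simp add: ac_simps)
  with assms show ?thesis by (simp only: fps_X_power_mult_nth) simp
qed

lemma fps_nth_signed_monomial_nonzeroD:
  assumes "fps_nth ((-1) ^ s * fps_X ^ m :: 'a::comm_ring_1 fps) i \<noteq> 0"
  shows "i = m"
  using assms by (cases "even s") (auto split: if_splits)

lemma double_sum_atMost: "2 * \<Sum>{..n::nat} = n * Suc n"
  by (induction n) auto

text \<open>Up to degree n, only e times the pentagonal numbers N(3N-1)/2 and N(3N+1)/2 survive as
  exponents in Shanks' identity at q^e, and 24 times these numbers plus 1 is (6N-1)^2 or (6N+1)^2.
  The case e = 1 is the Euler function; e = 2 serves the factor 1 - q^(2j) in Gauss's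
  identity.\<close>

lemma euler_function_support:
  fixes i n e :: nat
  assumes "e > 0" "i \<le> n"
    and nz: "fps_nth (\<Prod>j=1..n. 1 - (fps_X ^ e) ^ j :: 'a::comm_ring_1 fps) i \<noteq> 0"
  shows "\<exists>x :: int. 24 * int i + int e = int e * x\<^sup>2"
proof -
  define q :: "'a fps" where "q = fps_X ^ e"
  let ?t = "\<lambda>s. \<Sum>{..Suc s}"
  let ?R = "\<lambda>s. (-1) ^ Suc s * q ^ (Suc s * n + ?t s) * (\<Prod>j=Suc (Suc s)..n. 1 - q ^ j)"
  let ?U = "\<lambda>s. (-1) ^ Suc s * q ^ (Suc s * s + ?t s)"
    and ?V = "\<lambda>s. (-1) ^ Suc s * q ^ (Suc s * Suc s + ?t s)"
  have "(\<Prod>j=1..n. 1 - q ^ j) + (\<Sum>s<n. ?R s) = 1 + (\<Sum>s<n. ?U s + ?V s)"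
    using shanks_pentagonal[where n = n and q = q] by (simp only: sum.atMost_shift) (simp add: distrib_left)
  moreover have R: "fps_nth (?R s) i = 0" for s
  proof -
    have "i < Suc s * n + ?t s" using assms(2) by simp
    also have "\<dots> = 1 * (Suc s * n + ?t s)" by simp
    also have "\<dots> \<le> e * (Suc s * n + ?t s)"
      using assms(1) by (intro mult_le_mono1) simp
    finally show ?thesis
      unfolding q_def power_mult[symmetric] by (rule fps_nth_signed_monomial_mult_eq_0)
  qed
  moreover have "fps_nth ((\<Prod>j=1..n. 1 - q ^ j) + (\<Sum>s<n. ?R s)) i =
      fps_nth (\<Prod>j=1..n. 1 - q ^ j) i"
    by (simp only: fps_add_nth fps_sum_nth R) simp
  ultimately have "fps_nth (\<Prod>j=1..n. 1 - q ^ j) i = fps_nth (1 + (\<Sum>s<n. ?U s + ?V s)) i"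
    by simp
  with nz have "fps_nth (1 + (\<Sum>s<n. ?U s + ?V s)) i \<noteq> 0" by (simp add: q_def)
  then have "i = 0 \<or> (\<exists>s. fps_nth (?U s) i \<noteq> 0 \<or> fps_nth (?V s) i \<noteq> 0)"
  proof (rule contrapos_np)
    assume *: "\<not> (i = 0 \<or> (\<exists>s. fps_nth (?U s) i \<noteq> 0 \<or> fps_nth (?V s) i \<noteq> 0))"
    then have UV: "fps_nth (?U s) i = 0" "fps_nth (?V s) i = 0" for s by blast+
    from * have "i \<noteq> 0" unfolding de_Morgan_disj by (rule conjunct1)
    then show "fps_nth (1 + (\<Sum>s<n. ?U s + ?V s)) i = 0"
      by (simp only: fps_add_nth fps_sum_nth UV) simp
  qed
  then consider "i = 0" | s where "i = e * (Suc s * s + ?t s)"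
    | s where "i = e * (Suc s * Suc s + ?t s)"
    unfolding q_def power_mult[symmetric] by (blast dest: fps_nth_signed_monomial_nonzeroD)
  then show ?thesis
  proof cases
    case 1
    then show ?thesis by (intro exI[of _ 1]) simp
  next
    case 2
    have "24 * i + e = e * (24 * (Suc s * s) + 12 * (2 * ?t s) + 1)"
      by (simp only: 2) (simp add: algebra_simps)
    also have "\<dots> = e * (6 * s + 5)\<^sup>2"
      by (simp only: double_sum_atMost) (simp add: algebra_simps power2_eq_square)
    finally have "int (24 * i + e) = int (e * (6 * s + 5)\<^sup>2)" by simp
    then show ?thesis by (intro exI[of _ "int (6 * s + 5)"]) simp
  next
    case 3
    have "24 * i + e = e * (24 * (Suc s * Suc s) + 12 * (2 * ?t s) + 1)"
      by (simp only: 3) (simp add: algebra_simps)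
    also have "\<dots> = e * (6 * s + 7)\<^sup>2"
      by (simp only: double_sum_atMost) (simp add: algebra_simps power2_eq_square)
    finally have "int (24 * i + e) = int (e * (6 * s + 7)\<^sup>2)" by simp
    then show ?thesis by (intro exI[of _ "int (6 * s + 7)"]) simp
  qed
qed

text \<open>A nonzero coefficient of the product of two Euler functions needs i = u + v with 24u + 1
  and 24v + 1 both squares.\<close>

lemma euler_function_sq_support_gaussian:
  fixes i n :: nat
  assumes "i \<le> n"
    and nz: "fps_nth ((\<Prod>j=1..n. 1 - fps_X ^ j :: 'a::comm_ring_1 fps)\<^sup>2) i \<noteq> 0"
  obtains x y :: int where "24 * int i + 2 = x\<^sup>2 + y\<^sup>2"
proof -
  from nz obtain u where u: "u \<le> i"
    "fps_nth (\<Prod>j=1..n. 1 - fps_X ^ j :: 'a fps) u \<noteq> 0"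
    "fps_nth (\<Prod>j=1..n. 1 - fps_X ^ j :: 'a fps) (i - u) \<noteq> 0"
    unfolding power2_eq_square by (rule fps_nth_mult_nonzeroE)
  have "\<exists>x :: int. 24 * int u + 1 = x\<^sup>2"
    using euler_function_support[of 1 u n, where 'a = 'a] u assms(1) by simp
  moreover have "\<exists>y :: int. 24 * int (i - u) + 1 = y\<^sup>2"
    using euler_function_support[of 1 "i - u" n, where 'a = 'a] u assms(1) by simp
  ultimately obtain x y :: int where "24 * int u + 1 = x\<^sup>2" "24 * int (i - u) + 1 = y\<^sup>2"
    by blast
  then show ?thesis using u(1) by (intro that[of x y]) simp
qed

text \<open>By Gauss's identity i = u + y^2 with u in the support of the Euler function at q^2, for
  which 12u + 1 is a square.\<close>

lemma euler_function_sq_support_eisenstein: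
  fixes i n :: nat
  assumes "i \<le> n"
    and nz: "fps_nth ((\<Prod>j=1..n. 1 - fps_X ^ j :: 'a::comm_ring_1 fps)\<^sup>2) i \<noteq> 0"
  obtains x y :: int where "12 * int i + 1 = x\<^sup>2 + 12 * y\<^sup>2"
proof -
  define P :: "'a fps" where "P = (\<Prod>j=1..n. 1 - fps_X ^ j)"
  define Q :: "'a fps" where "Q = (\<Prod>j=1..n. 1 - (fps_X ^ 2) ^ j)"
  define S :: "'a fps" where "S = 1 + 2 * (\<Sum>s<n. (-1) ^ Suc s * fps_X ^ (Suc s)\<^sup>2)"
  \<comment> \<open>\<open>?R s\<close> is the summand of index s + 1 in
    \<open>shanks_gauss\<close>; it is divisible by q^(n+1), so it does not reach the coefficient at
    i. The identity is then multiplied by \<open>P\<close>, because (1 - q^j)(1 + q^j) = 1 - q^(2j)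
    turns the product on the right into \<open>Q\<close>.\<close>
  let ?R = "\<lambda>s. (-1) ^ Suc s * fps_X ^ (Suc s * Suc n) * ((\<Prod>j<Suc s. 1 + fps_X ^ j) *
    (\<Prod>j=Suc (Suc s)..n. 1 - fps_X ^ j)) :: 'a fps"
  have "P\<^sup>2 + (\<Sum>s<n. ?R s * P) = (P + (\<Sum>s<n. ?R s)) * P"
    by (simp only: power2_eq_square distrib_right sum_distrib_right)
  also have "P + (\<Sum>s<n. ?R s) = (\<Prod>j=1..n. 1 + fps_X ^ j) * S"
    using shanks_gauss[where n = n and q = "fps_X :: 'a fps"] unfolding P_def S_def
    by (simp only: sum.atMost_shift) (simp add: mult.assoc)
  also have "\<dots> * P = P * (\<Prod>j=1..n. 1 + fps_X ^ j) * S"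
    by (simp only: ac_simps)
  also have "P * (\<Prod>j=1..n. 1 + fps_X ^ j) = Q"
    unfolding P_def Q_def prod.distrib[symmetric]
    by (intro prod.cong) (simp_all add: algebra_simps flip: power_mult power_add mult_2)
  finally have "P\<^sup>2 + (\<Sum>s<n. ?R s * P) = Q * S" .
  moreover have R: "fps_nth (?R s * P) i = 0" for s
    unfolding mult.assoc[of "(-1) ^ Suc s * fps_X ^ (Suc s * Suc n)"]
    using assms(1) by (intro fps_nth_signed_monomial_mult_eq_0) simp
  moreover have "fps_nth (P\<^sup>2 + (\<Sum>s<n. ?R s * P)) i = fps_nth (P\<^sup>2) i"
    by (simp only: fps_add_nth fps_sum_nth R) simp
  ultimately have "fps_nth (P\<^sup>2) i = fps_nth (Q * S) i" by simp
  with nz have "fps_nth (Q * S) i \<noteq> 0" by (simp add: P_def)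
  then obtain u where u: "u \<le> i" "fps_nth Q u \<noteq> 0" "fps_nth S (i - u) \<noteq> 0"
    by (rule fps_nth_mult_nonzeroE)
  obtain x :: int where x: "24 * int u + 2 = 2 * x\<^sup>2"
    using euler_function_support[of 2 u n, where 'a = 'a] u(1,2) assms(1)
    unfolding Q_def by auto
  \<comment> \<open>\<open>S\<close> is a truncated theta series: its exponents are squares, the
    constant term 1 standing for the square 0.\<close>
  have "\<exists>y. i - u = y\<^sup>2"
  proof (rule ccontr)
    assume "\<nexists>y. i - u = y\<^sup>2"
    then have "fps_nth ((-1) ^ Suc s * fps_X ^ (Suc s)\<^sup>2 :: 'a fps) (i - u) = 0" for s
      using fps_nth_signed_monomial_nonzeroD by blast
    moreover have "i - u \<noteq> 0" using \<open>\<nexists>y. i - u = y\<^sup>2\<close> by (metis zero_power2)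
    ultimately have "fps_nth S (i - u) = 0"
      unfolding S_def mult_2 by (simp add: fps_sum_nth del: power_Suc)
    with u(3) show False by simp
  qed
  then obtain y where "i - u = y\<^sup>2" by blast
  then have "int i = int u + (int y)\<^sup>2" using u(1)
    by (metis le_add_diff_inverse of_nat_add of_nat_power)
  with x show ?thesis by (intro that[of x "int y"]) simp
qed

subsection \<open>Anisotropic binary quadratic forms\<close>

text \<open>Infinite descent: if p divides the form, it divides both variables, so p^2 can be
  cancelled. As the exponent is odd, the descent stops at a single p, and there the same argument
  forces another p into w.\<close>

lemma anisotropic_form_even_valuation:
  fixes x y c w p :: int
  assumes "p \<noteq> 0" and aniso: "\<And>x y. p dvd x\<^sup>2 + c * y\<^sup>2 \<Longrightarrow> p dvd x \<and> p dvd y"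
    and "x\<^sup>2 + c * y\<^sup>2 = p ^ (2 * m + 1) * w"
  shows "p dvd w"
  using assms(3)
proof (induction m arbitrary: x y)
  case (0 x y)
  then have "p dvd x\<^sup>2 + c * y\<^sup>2" by simp
  then obtain x' y' where "x = p * x'" "y = p * y'" using aniso by (meson dvdE)
  with 0 have "p * (p * (x'\<^sup>2 + c * y'\<^sup>2)) = p * w" by (simp add: algebra_simps power2_eq_square)
  with \<open>p \<noteq> 0\<close> have "w = p * (x'\<^sup>2 + c * y'\<^sup>2)" by simp
  then show ?case by simp
next
  case (Suc m x y)
  then have "p dvd x\<^sup>2 + c * y\<^sup>2" by simp
  then obtain x' y' where "x = p * x'" "y = p * y'" using aniso by (meson dvdE)
  with Suc.prems have "p\<^sup>2 * (x'\<^sup>2 + c * y'\<^sup>2) = p\<^sup>2 * (p ^ (2 * m + 1) * w)"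
    by (simp add: algebra_simps power2_eq_square)
  with \<open>p \<noteq> 0\<close> have "x'\<^sup>2 + c * y'\<^sup>2 = p ^ (2 * m + 1) * w" by simp
  then show ?case by (rule Suc.IH)
qed

text \<open>Divisibility by p depends only on residues, which leaves a finite check that can be
  evaluated.\<close>

lemma anisotropic_from_residues:
  fixes x y c p :: int
  assumes "p > 0" "p dvd x\<^sup>2 + c * y\<^sup>2"
    and "\<forall>a\<in>set [0..p - 1]. \<forall>b\<in>set [0..p - 1]. (a\<^sup>2 + c * b\<^sup>2) mod p = 0 \<longrightarrow> a = 0 \<and> b = 0"
  shows "p dvd x \<and> p dvd y"
proof -
  have "((x mod p)\<^sup>2 + c * (y mod p)\<^sup>2) mod p = (x\<^sup>2 + c * y\<^sup>2) mod p"
    by (intro mod_add_cong mod_mult_cong refl) (simp_all add: power_mod)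
  then have "((x mod p)\<^sup>2 + c * (y mod p)\<^sup>2) mod p = 0" using assms(2) by simp
  moreover have "x mod p \<in> set [0..p - 1]" "y mod p \<in> set [0..p - 1]" using assms(1) by auto
  ultimately show ?thesis using assms(3) by (meson mod_eq_0_iff_dvd)
qed

text \<open>Here -12 is 3 modulo 5, a quadratic nonresidue.\<close>

lemma anisotropic_5: "(5::int) dvd x\<^sup>2 + 12 * y\<^sup>2 \<Longrightarrow> 5 dvd x \<and> 5 dvd y"
  by (erule anisotropic_from_residues[rotated]) code_simp+

text \<open>The form with coefficient 12 is isotropic modulo 7, since -12 is congruent to 3^2; but
  -1 is a nonresidue.\<close>

lemma anisotropic_7: "(7::int) dvd x\<^sup>2 + 1 * y\<^sup>2 \<Longrightarrow> 7 dvd x \<and> 7 dvd y"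
  by (erule anisotropic_from_residues[rotated]) code_simp+

text \<open>Here -12 is -1 modulo 11, a nonresidue because 11 is 3 modulo 4.\<close>

lemma anisotropic_11: "(11::int) dvd x\<^sup>2 + 12 * y\<^sup>2 \<Longrightarrow> 11 dvd x \<and> 11 dvd y"
  by (erule anisotropic_from_residues[rotated]) code_simp+

subsection \<open>Congruences between $p$-integral rational numbers\<close>

text \<open>\<open>local_multiple p M x\<close> says that $x \in M\,\mathbb{Z}_{(p)}$ for a prime $p$.\<close>

definition local_multiple :: "int \<Rightarrow> int \<Rightarrow> rat \<Rightarrow> bool" where
  "local_multiple p M x \<longleftrightarrow> (\<exists>d a. coprime d p \<and> of_int d * x = of_int (M * a))"

lemma local_multiple_0 [simp]: "local_multiple p M 0"
  unfolding local_multiple_def by (intro exI[of _ 1] exI[of _ 0]) simp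

lemma local_multiple_of_int: "local_multiple p M (of_int (M * a))"
  unfolding local_multiple_def by (intro exI[of _ 1] exI[of _ a]) simp

lemma local_multiple_add:
  assumes "local_multiple p M x" "local_multiple p M y"
  shows "local_multiple p M (x + y)"
proof -
  obtain d a e b where da: "coprime d p" "of_int d * x = of_int (M * a)"
    and eb: "coprime e p" "of_int e * y = of_int (M * b)"
    using assms unfolding local_multiple_def by blast
  have "of_int (d * e) * (x + y) = of_int e * (of_int d * x) + of_int d * (of_int e * y)"
    by (simp add: algebra_simps)
  also have "\<dots> = of_int (M * (e * a + d * b))"
    by (simp only: da eb) (simp add: algebra_simps)
  finally show ?thesis
    using da(1) eb(1) unfolding local_multiple_def by (metis coprime_mult_left_iff)
qed

lemma local_multiple_mult:
  assumes "local_multiple p M x" "local_multiple p N y"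
  shows "local_multiple p (M * N) (x * y)"
proof -
  obtain d a e b where da: "coprime d p" "of_int d * x = of_int (M * a)"
    and eb: "coprime e p" "of_int e * y = of_int (N * b)"
    using assms unfolding local_multiple_def by blast
  have "of_int (d * e) * (x * y) = (of_int d * x) * (of_int e * y)" by simp
  also have "\<dots> = of_int (M * N * (a * b))"
    by (simp only: da eb) simp
  finally show ?thesis
    using da(1) eb(1) unfolding local_multiple_def by (metis coprime_mult_left_iff)
qed

lemma local_multiple_dvd: "local_multiple p M x \<Longrightarrow> N dvd M \<Longrightarrow> local_multiple p N x"
  unfolding local_multiple_def by (metis dvdE mult.assoc)

lemma local_multiple_sum:
  "(\<And>i. i \<in> A \<Longrightarrow> local_multiple p M (f i)) \<Longrightarrow> local_multiple p M (sum f A)"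
  by (induction A rule: infinite_finite_induct) (auto intro: local_multiple_add)

lemma rat_cong_zero_if_local_multiple:
  assumes "local_multiple p (p ^ e) x"
  shows "rat_cong_zero x (p ^ e)"
proof -
  obtain u v where uv: "quotient_of x = (u, v)" by fastforce
  obtain d a where da: "coprime d p" "of_int d * x = of_int (p ^ e * a)"
    using assms unfolding local_multiple_def by blast
  have "v > 0" "x = of_int u / of_int v"
    using uv quotient_of_denom_pos quotient_of_div by blast+
  with da(2) have "(of_int (d * u) :: rat) = of_int (p ^ e * a * v)" by (simp add: field_simps)
  then have "d * u = p ^ e * (a * v)" by (simp only: of_int_eq_iff mult.assoc)
  then have "p ^ e dvd d * u" by simp
  moreover have "coprime (p ^ e) d" using da(1) by (simp add: coprime_commute)
  ultimately have "p ^ e dvd u" by (simp add: coprime_dvd_mult_right_iff)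
  then show ?thesis by (simp add: rat_cong_zero_def uv)
qed

text \<open>Only the p-part of m! has to be cancelled. Modulo that power of p, b has an inverse b',
  so c/b may be replaced by the integer c b', for which m! divides the product of consecutive
  integers.\<close>

lemma local_multiple_gbinomial:
  fixes p b c :: int
  assumes "prime p" "coprime b p"
  shows "local_multiple p 1 ((of_int c / of_int b) gchoose m)"
proof -
  have "b \<noteq> 0" using assms by auto
  obtain u where u: "fact m = p ^ multiplicity p (fact m :: int) * u" "\<not> p dvd u"
    by (rule multiplicity_decompose'[of "fact m :: int" p]) (use assms(1) in auto)
  let ?e = "multiplicity p (fact m :: int)"
  have "coprime b (p ^ ?e)" using assms(2) by simp
  then obtain b' where b': "[b * b' = 1] (mod p ^ ?e)"
    using cong_solve_coprime_int by blast
  have "[(\<Prod>i=0..<m. c * b' - int i) = b' ^ m * (\<Prod>i=0..<m. c - int i * b)] (mod p ^ ?e)"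
  proof -
    have "[(\<Prod>i=0..<m. c * b' - int i * 1) = (\<Prod>i=0..<m. c * b' - int i * (b * b'))] (mod p ^ ?e)"
      by (intro cong_prod cong_diff cong_mult cong_refl cong_sym[OF b'])
    also have "(\<Prod>i=0..<m. c * b' - int i * (b * b')) = (\<Prod>i=0..<m. b' * (c - int i * b))"
      by (simp add: algebra_simps)
    finally show ?thesis by (simp add: prod.distrib)
  qed
  moreover have "p ^ ?e dvd (\<Prod>i=0..<m. c * b' - int i)"
    unfolding gbinomial_int_mult_fact[symmetric] by (rule dvd_mult2) (rule multiplicity_dvd)
  ultimately have "p ^ ?e dvd b' ^ m * (\<Prod>i=0..<m. c - int i * b)"
    using cong_dvd_iff by blast
  moreover have "coprime (p ^ ?e) (b' ^ m)"
    using b' by (metis coprime_commute coprime_iff_invertible_int coprime_power_right_iff mult.commute)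
  ultimately obtain z where z: "(\<Prod>i=0..<m. c - int i * b) = p ^ ?e * z"
    by (auto simp: coprime_dvd_mult_right_iff)
  have "of_int (p ^ ?e) * (of_int (b ^ m * u) * ((of_int c / of_int b) gchoose m)) =
      of_int b ^ m * (fact m * ((of_int c / of_int b :: rat) gchoose m))"
    by (subst (2) of_int_fact[symmetric]) (subst u(1), simp)
  also have "\<dots> = (\<Prod>i=0..<m. of_int b * (of_int c / of_int b - of_nat i))"
    by (simp add: gbinomial_mult_fact prod.distrib)
  also have "\<dots> = of_int (p ^ ?e * z)"
    unfolding z[symmetric] of_int_prod using \<open>b \<noteq> 0\<close>
    by (intro prod.cong) (simp_all add: field_simps)
  finally have "of_int (b ^ m * u) * ((of_int c / of_int b) gchoose m) = (of_int (1 * z) :: rat)"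
    using assms(1) by simp
  moreover have "coprime (b ^ m * u) p"
    using assms u(2) by (simp add: prime_imp_coprime coprime_commute)
  ultimately show ?thesis unfolding local_multiple_def by blast
qed

lemma local_multiple_gbinomial_prime_power:
  fixes p b :: int
  assumes "prime p" "coprime b p" "h \<le> k" "\<not> p ^ h dvd int m"
  shows "local_multiple p (p ^ (k - h + 1)) ((of_int (- (p ^ k)) / of_int b) gchoose m)"
proof -
  define v where "v = multiplicity p (int m)"
  have "m > 0" using assms(4) by (auto intro: gr0I)
  obtain u where u: "int m = p ^ v * u" "\<not> p dvd u"
    unfolding v_def
    by (rule multiplicity_decompose'[of "int m" p]) (use assms(1) \<open>m > 0\<close> in auto)
  have "v < h"
    using assms(4) u(1) by (metis dvd_mult2 le_imp_power_dvd not_le)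
  have [simp]: "b \<noteq> 0" "p \<noteq> 0" "u \<noteq> 0" using assms u by auto
  let ?a = "of_int (- (p ^ k)) / of_int b :: rat"
  \<comment> \<open>The quotient of p^k by m has p-adic valuation k - v, and v < h makes this at
    least k - h + 1; h - 1 - v is the surplus.\<close>
  have "k = v + (k - h + 1) + (h - 1 - v)" using \<open>v < h\<close> assms(3) by simp
  then have "p ^ k = p ^ v * p ^ (k - h + 1) * p ^ (h - 1 - v)" by (metis power_add)
  moreover have "(of_nat m :: rat) = of_int (p ^ v * u)" using u(1) by (metis of_int_of_nat_eq)
  ultimately have "of_int (b * u) * (?a / of_nat m) = of_int (p ^ (k - h + 1) * - (p ^ (h - 1 - v)))"
    by simp
  moreover have "coprime (b * u) p"
    using assms(1,2) u(2) by (simp add: prime_imp_coprime coprime_commute)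
  ultimately have "local_multiple p (p ^ (k - h + 1)) (?a / of_nat m)"
    unfolding local_multiple_def by blast
  moreover have "?a - 1 = of_int (- (p ^ k) - b) / of_int b"
    by (simp add: field_simps)
  then have "local_multiple p 1 ((?a - 1) gchoose (m - 1))"
    using local_multiple_gbinomial[OF assms(1,2)] by metis
  ultimately show ?thesis
    unfolding gbinomial_absorption'[OF \<open>m > 0\<close>] by (metis local_multiple_mult mult.right_neutral)
qed

subsection \<open>Power series that are congruent to a series in $q^D$\<close>

text \<open>Integrality at p is also demanded at the multiples of D; this makes the property stable
  under products. With D = M = 1 it is plain integrality at p.\<close>

definition coeffs_multiple_off :: "int \<Rightarrow> int \<Rightarrow> int \<Rightarrow> rat fps \<Rightarrow> bool" where
  "coeffs_multiple_off p D M F \<longleftrightarrow>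
    (\<forall>n. local_multiple p (if D dvd int n then 1 else M) (fps_nth F n))"

lemma coeffs_multiple_off_1: "coeffs_multiple_off p D M 1"
  using local_multiple_of_int[of p 1 1] by (simp add: coeffs_multiple_off_def)

text \<open>If D does not divide n, it fails to divide i or n - i, and the corresponding coefficient
  supplies the factor M.\<close>

lemma coeffs_multiple_off_mult:
  assumes "coeffs_multiple_off p D M F" "coeffs_multiple_off p D M G"
  shows "coeffs_multiple_off p D M (F * G)"
  unfolding coeffs_multiple_off_def fps_mult_nth
proof (intro allI local_multiple_sum)
  fix n i :: nat assume "i \<in> {0..n}"
  let ?c = "\<lambda>n. if D dvd int n then 1 else M"
  have "local_multiple p (?c i * ?c (n - i)) (fps_nth F i * fps_nth G (n - i))"
    using assms unfolding coeffs_multiple_off_def by (intro local_multiple_mult) blast+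
  moreover have "D dvd int n" if "D dvd int i" "D dvd int (n - i)"
    using dvd_add[OF that] \<open>i \<in> {0..n}\<close> by simp
  then have "?c n dvd ?c i * ?c (n - i)" by auto
  ultimately show "local_multiple p (?c n) (fps_nth F i * fps_nth G (n - i))"
    by (rule local_multiple_dvd)
qed

lemma coeffs_multiple_off_prod:
  "(\<And>i. i \<in> A \<Longrightarrow> coeffs_multiple_off p D M (f i)) \<Longrightarrow> coeffs_multiple_off p D M (prod f A)"
  by (induction A rule: infinite_finite_induct)
    (auto intro: coeffs_multiple_off_mult coeffs_multiple_off_1)

text \<open>Substituting -q^(j+1) moves the coefficient at i to (j+1)i, up to sign, and multiples of
  D go to multiples of D.\<close>

lemma coeffs_multiple_off_binom_factor:
  assumes "\<And>m. local_multiple p (if D dvd int m then 1 else M) (t gchoose m)"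
  shows "coeffs_multiple_off p D M (binom_factor t j)"
  unfolding coeffs_multiple_off_def binom_factor_def fps_compose_nth
proof (intro allI local_multiple_sum)
  fix n i :: nat
  let ?c = "\<lambda>n. if D dvd int n then 1 else M"
  have eq: "(- (fps_X ^ Suc j)) ^ i = (-1) ^ i * (fps_X ^ (Suc j * i) :: rat fps)"
    by (simp only: power_minus[of "fps_X ^ Suc j"] power_mult)
  have nth: "fps_nth ((- (fps_X ^ Suc j)) ^ i :: rat fps) n = (if n = Suc j * i then (-1) ^ i else 0)"
    unfolding eq by (cases "even i") (simp_all del: power_Suc mult_Suc)
  show "local_multiple p (?c n) (fps_nth (fps_binomial t) i * fps_nth ((- (fps_X ^ Suc j)) ^ i) n)"
  proof (cases "n = Suc j * i")
    case True
    have "local_multiple p (?c i * 1) ((t gchoose i) * of_int (1 * (-1) ^ i))"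
      by (intro local_multiple_mult assms local_multiple_of_int)
    moreover have "?c n dvd ?c i * 1" using True by auto
    ultimately have "local_multiple p (?c n) ((t gchoose i) * of_int (1 * (-1) ^ i))"
      by (rule local_multiple_dvd)
    then show ?thesis unfolding nth using True by simp
  next
    case False
    then show ?thesis unfolding nth by simp
  qed
qed

lemma binom_factor_add: "binom_factor (a + b) j = binom_factor a j * binom_factor b j"
  unfolding binom_factor_def fps_binomial_add_mult by (rule fps_compose_mult_distrib) simp

lemma binom_factor_1: "binom_factor 1 j = 1 - fps_X ^ Suc j"
  unfolding binom_factor_def fps_binomial_1 by (simp add: fps_compose_add_distrib)

lemma local_multiple_frac_part:
  fixes p b :: int
  assumes "prime p" "coprime b p" "h \<le> k"
    and vanish: "\<And>i. i \<le> N \<Longrightarrow> p ^ h dvd int (N - i) \<Longrightarrow>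
      fps_nth ((\<Prod>j=1..Suc N. 1 - fps_X ^ j :: rat fps)\<^sup>2) i = 0"
  shows "local_multiple p (p ^ (k - h + 1)) (frac_part (2 + of_int (- (p ^ k)) / of_int b) N)"
proof -
  let ?a = "of_int (- (p ^ k)) / of_int b :: rat" and ?M = "p ^ (k - h + 1)"
  define F :: "rat fps" where "F = (\<Prod>j\<le>N. binom_factor 1 j)\<^sup>2"
  define G where "G = (\<Prod>j\<le>N. binom_factor ?a j)"
  have "binom_factor (2 + ?a) j = (binom_factor 1 j)\<^sup>2 * binom_factor ?a j" for j
    using binom_factor_add[of 2 ?a j] binom_factor_add[of 1 1 j]
    by (simp add: power2_eq_square)
  then have frac_part: "frac_part (2 + ?a) N = fps_nth (F * G) N"
    by (simp add: frac_part_eq F_def G_def prod.distrib prod_power_distrib)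
  \<comment> \<open>\<open>binom_factor 1 j\<close> is 1 - q^(j+1), so the indices j up to N become
    the exponents 1 to N + 1.\<close>
  have F: "F = (\<Prod>j=1..Suc N. 1 - fps_X ^ j)\<^sup>2"
    by (simp only: F_def binom_factor_1 One_nat_def prod.atLeast1_atMost_eq lessThan_Suc_atMost)
  have "local_multiple p (if 1 dvd int m then 1 else 1) (1 gchoose m)" for m
    using local_multiple_gbinomial[of p 1 1 m] assms(1) by simp
  then have "coeffs_multiple_off p 1 1 F"
    unfolding F_def power2_eq_square
    by (intro coeffs_multiple_off_mult coeffs_multiple_off_prod coeffs_multiple_off_binom_factor)
  then have F_integral: "local_multiple p 1 (fps_nth F i)" for i
    by (simp add: coeffs_multiple_off_def)
  have "local_multiple p ?M (fps_nth (F * G) N)"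
    unfolding fps_mult_nth
  proof (intro local_multiple_sum)
    fix i assume i: "i \<in> {0..N}"
    have "local_multiple p (if p ^ h dvd int m then 1 else ?M) (?a gchoose m)" for m
      using local_multiple_gbinomial[OF assms(1,2), of "- (p ^ k)" m]
        local_multiple_gbinomial_prime_power[OF assms(1-3), of m]
      by (cases "p ^ h dvd int m") (simp_all only: if_True if_False not_False_eq_True)
    then have "coeffs_multiple_off p (p ^ h) ?M G"
      unfolding G_def by (intro coeffs_multiple_off_prod coeffs_multiple_off_binom_factor)
    then have G: "local_multiple p (if p ^ h dvd int (N - i) then 1 else ?M) (fps_nth G (N - i))"
      unfolding coeffs_multiple_off_def by blast
    show "local_multiple p ?M (fps_nth F i * fps_nth G (N - i))"
    proof (cases "p ^ h dvd int (N - i)")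
      case True
      then show ?thesis using vanish[of i] i F by simp
    next
      case False
      then have "local_multiple p (1 * ?M) (fps_nth F i * fps_nth G (N - i))"
        using G by (intro local_multiple_mult F_integral) simp
      then show ?thesis by simp
    qed
  qed
  then show ?thesis by (simp only: frac_part)
qed

section \<open>The congruences for 5, 7 and 11\<close>

text \<open>The parameters g and c cover both representations: g = 1, c = 12 for 12i + 1, and g = 2,
  c = 1 for 24i + 2.\<close>

lemma frac_part_cong_zero:
  fixes p k s b n r :: nat and c g :: int
  assumes "prime p" "p\<^sup>2 mod 12 = 1" "\<not> p dvd 12" "\<not> int p dvd g"
    and aniso: "\<And>x y. int p dvd x\<^sup>2 + c * y\<^sup>2 \<Longrightarrow> int p dvd x \<and> int p dvd y"
    and repr: "\<And>i n. i \<le> n \<Longrightarrow> fps_nth ((\<Prod>j=1..n. 1 - fps_X ^ j :: rat fps)\<^sup>2) i \<noteq> 0 \<Longrightarrow>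
      \<exists>x y. g * (12 * int i + 1) = x\<^sup>2 + c * y\<^sup>2"
    and "s \<ge> 1" "s \<le> k div 2" "b > 0" "coprime b p" "r > 0" "r < p"
  shows "rat_cong_zero
    (frac_part (- (of_nat p ^ k - 2 * of_nat b) / of_nat b)
      (p ^ (2 * s) * n + p ^ (2 * s - 1) * r + (p ^ (2 * s) - 1) div 12))
    (int p ^ (k - 2 * s + 1))"
proof -
  define N where "N = p ^ (2 * s) * n + p ^ (2 * s - 1) * r + (p ^ (2 * s) - 1) div 12"
  define m where "m = s - 1"
  have s: "2 * s = 2 * m + 2" "2 * s - 1 = 2 * m + 1" using assms(7) by (simp_all add: m_def)
  \<comment> \<open>This makes the division of p^(2s) - 1 by 12 exact.\<close>
  have "p ^ (2 * s) mod 12 = (p\<^sup>2 mod 12) ^ s mod 12" by (simp add: power_mult power_mod)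
  also have "\<dots> = 1" by (simp add: assms(2))
  finally have "p ^ (2 * s) mod 12 = 1" .
  moreover have "12 * ((m - 1) div 12) + 1 = m" if "m mod 12 = 1" for m :: nat
    using that by presburger
  ultimately have "12 * ((p ^ (2 * s) - 1) div 12) + 1 = p ^ (2 * s)" by blast
  then have "12 * N + 1 = 12 * (p ^ (2 * s) * n + p ^ (2 * s - 1) * r) + p ^ (2 * s)"
    unfolding N_def by simp
  also have "\<dots> = p ^ (2 * m + 1) * (p * (12 * n + 1) + 12 * r)"
    unfolding s by (simp add: algebra_simps)
  finally have "int (12 * N + 1) = int (p ^ (2 * m + 1) * (p * (12 * n + 1) + 12 * r))"
    by (simp only:)
  then have N: "12 * int N + 1 = int p ^ (2 * m + 1) * (int p * (12 * int n + 1) + 12 * int r)"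
    by (simp only: of_nat_add of_nat_mult of_nat_power of_nat_numeral of_nat_1)
  have "fps_nth ((\<Prod>j=1..Suc N. 1 - fps_X ^ j :: rat fps)\<^sup>2) i = 0"
    if i: "i \<le> N" "int p ^ (2 * s) dvd int (N - i)" for i
  proof (rule ccontr)
    assume "fps_nth ((\<Prod>j=1..Suc N. 1 - fps_X ^ j :: rat fps)\<^sup>2) i \<noteq> 0"
    then obtain x y where "g * (12 * int i + 1) = x\<^sup>2 + c * y\<^sup>2"
      using repr[of i "Suc N"] i(1) by auto
    moreover obtain z where "int (N - i) = int p ^ (2 * s) * z" using i(2) by (elim dvdE)
    then have "int i = int N - int p ^ (2 * m + 1) * int p * z"
      using i(1) unfolding s by (simp add: algebra_simps)
    ultimately have "x\<^sup>2 + c * y\<^sup>2 =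
        g * ((12 * int N + 1) - 12 * (int p ^ (2 * m + 1) * int p * z))"
      by (simp add: algebra_simps)
    \<comment> \<open>Since i and N differ by a multiple of p^(2s), the power p^(2s-1) still splits
      off 12i + 1, with a cofactor congruent to 12r modulo p.\<close>
    also have "\<dots> = int p ^ (2 * m + 1) * (g * (int p * (12 * int n + 1 - 12 * z) + 12 * int r))"
      unfolding N by (simp only: algebra_simps)
    finally have xy: "x\<^sup>2 + c * y\<^sup>2 = \<dots>" .
    \<comment> \<open>Descent forces p into the cofactor; as p divides neither g nor 12, it would
      divide r, against 0 < r < p.\<close>
    have "int p dvd g * (int p * (12 * int n + 1 - 12 * z) + 12 * int r)"
      by (rule anisotropic_form_even_valuation[OF _ aniso xy]) (use assms(1) in auto)
    then have "int p dvd int p * (12 * int n + 1 - 12 * z) + 12 * int r"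
      using assms(1,4) by (simp add: prime_dvd_mult_iff)
    then have "int p dvd int (12 * r)" by (simp add: dvd_add_right_iff)
    then have "p dvd 12 * r" by (simp only: int_dvd_int_iff)
    then have "p dvd r" using assms(1,3) by (simp add: prime_dvd_mult_iff)
    with assms(11,12) show False by (simp add: nat_dvd_not_less)
  qed
  then have "local_multiple (int p) (int p ^ (k - 2 * s + 1))
      (frac_part (2 + of_int (- (int p ^ k)) / of_int (int b)) N)"
    using assms(1,8,10) by (intro local_multiple_frac_part) auto
  moreover have "2 + of_int (- (int p ^ k)) / of_int (int b) =
      (- (of_nat p ^ k - 2 * of_nat b) / of_nat b :: rat)"
    using assms(9) by (simp add: field_simps)
  ultimately have "local_multiple (int p) (int p ^ (k - 2 * s + 1))
      (frac_part (- (of_nat p ^ k - 2 * of_nat b) / of_nat b) N)"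
    by (simp only:)
  then show ?thesis
    unfolding N_def by (rule rat_cong_zero_if_local_multiple)
qed

theorem theorem1p6:
  fixes k s :: nat
  assumes "k > 1" and "s \<ge> 1" and "s \<le> k div 2"
  shows "(\<forall>b n r :: nat. b > 0 \<longrightarrow> coprime b 5 \<longrightarrow> r \<in> {1..4} \<longrightarrow>
           rat_cong_zero
             (frac_part (- (5 ^ k - 2 * of_nat b) / of_nat b)
               (5 ^ (2 * s) * n + 5 ^ (2 * s - 1) * r + (5 ^ (2 * s) - 1) div 12))
             (5 ^ (k - 2 * s + 1))) \<and>
         (\<forall>b n r :: nat. b > 0 \<longrightarrow> coprime b 7 \<longrightarrow> r \<in> {1..6} \<longrightarrow>
           rat_cong_zero
             (frac_part (- (7 ^ k - 2 * of_nat b) / of_nat b)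
               (7 ^ (2 * s) * n + 7 ^ (2 * s - 1) * r + (7 ^ (2 * s) - 1) div 12))
             (7 ^ (k - 2 * s + 1))) \<and>
         (\<forall>b n r :: nat. b > 0 \<longrightarrow> coprime b 11 \<longrightarrow> r \<in> {1..10} \<longrightarrow>
           rat_cong_zero
             (frac_part (- (11 ^ k - 2 * of_nat b) / of_nat b)
               (11 ^ (2 * s) * n + 11 ^ (2 * s - 1) * r + (11 ^ (2 * s) - 1) div 12))
             (11 ^ (k - 2 * s + 1)))"
proof -
  have eisenstein: "\<exists>x y. 1 * (12 * int i + 1) = x\<^sup>2 + 12 * y\<^sup>2"
    if "i \<le> n" "fps_nth ((\<Prod>j=1..n. 1 - fps_X ^ j :: rat fps)\<^sup>2) i \<noteq> 0" for i n
    by (rule euler_function_sq_support_eisenstein[OF that]) auto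
  have gaussian: "\<exists>x y. 2 * (12 * int i + 1) = x\<^sup>2 + 1 * y\<^sup>2"
    if "i \<le> n" "fps_nth ((\<Prod>j=1..n. 1 - fps_X ^ j :: rat fps)\<^sup>2) i \<noteq> 0" for i n
    by (rule euler_function_sq_support_gaussian[OF that]) (simp, blast)
  have "rat_cong_zero
      (frac_part (- (of_nat 5 ^ k - 2 * of_nat b) / of_nat b)
        (5 ^ (2 * s) * n + 5 ^ (2 * s - 1) * r + (5 ^ (2 * s) - 1) div 12))
      (int 5 ^ (k - 2 * s + 1))" if "b > 0" "coprime b 5" "r \<in> {1..4}" for b n r :: nat
  proof (rule frac_part_cong_zero[where g = 1 and c = 12])
    show "int 5 dvd x\<^sup>2 + 12 * y\<^sup>2 \<Longrightarrow> int 5 dvd x \<and> int 5 dvd y" for x y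
      using anisotropic_5[of x y] by simp
    show "prime (5 :: nat)" by simp
  qed (use that assms eisenstein in simp_all)
  moreover have "rat_cong_zero
      (frac_part (- (of_nat 7 ^ k - 2 * of_nat b) / of_nat b)
        (7 ^ (2 * s) * n + 7 ^ (2 * s - 1) * r + (7 ^ (2 * s) - 1) div 12))
      (int 7 ^ (k - 2 * s + 1))" if "b > 0" "coprime b 7" "r \<in> {1..6}" for b n r :: nat
  proof (rule frac_part_cong_zero[where g = 2 and c = 1])
    show "int 7 dvd x\<^sup>2 + 1 * y\<^sup>2 \<Longrightarrow> int 7 dvd x \<and> int 7 dvd y" for x y
      using anisotropic_7[of x y] by simp
    show "prime (7 :: nat)" by simp
  qed (use that assms gaussian in simp_all)
  moreover have "rat_cong_zero
      (frac_part (- (of_nat 11 ^ k - 2 * of_nat b) / of_nat b)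
        (11 ^ (2 * s) * n + 11 ^ (2 * s - 1) * r + (11 ^ (2 * s) - 1) div 12))
      (int 11 ^ (k - 2 * s + 1))" if "b > 0" "coprime b 11" "r \<in> {1..10}" for b n r :: nat
  proof (rule frac_part_cong_zero[where g = 1 and c = 12])
    show "int 11 dvd x\<^sup>2 + 12 * y\<^sup>2 \<Longrightarrow> int 11 dvd x \<and> int 11 dvd y" for x y
      using anisotropic_11[of x y] by simp
    show "prime (11 :: nat)" by simp
  qed (use that assms eisenstein in simp_all)
  ultimately show ?thesis by simp
qed

end
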